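(* Let $\mathcal{C}$ be a regular protomodular category with a fixed class $\mathcal{Z}$ of zero objects, with coreflector $\mathsf{Z}$. Let $(\mathcal{T},\mathcal{F})$ be a $\mathcal{Z}$-torsion theory in $\mathcal{C}$ satisfying Condition (M'), and let $\mathsf{F}\colon\mathcal{C}\to\mathcal{F}$ be the associated reflector, with unit $\eta$. Then: - every component of $\eta$ is a $\mathcal{Z}$-cokernel; - for every object $B$ of $\mathcal{C}$ and every arrow $f\colon A\to\mathsf{F}(B)$ of $\mathcal{F}$ inverted by $\mathsf{Z}$, $\mathsf{F}(f^*(\eta_B))$ is an isomorphism, where $f^*(\eta_B)$ is the pullback of $\eta_B$ along $f$; - $\mathsf{F}(Z)=Z$ for every $Z\in\mathcal{Z}$ (i.e. $\eta_Z$ is an isomorphism).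
   Context: A category is protomodular if it has pullbacks of split epimorphisms along any arrow and, whenever a split epimorphism $p\colon C\to B$ with section $s$ is pulled back along $f\colon A\to B$, giving $g\colon A\times_B C\to C$, the pair $(g,s)$ is jointly extremally epimorphic. A class of zero objects in a category $\mathcal{C}$ is a full subcategory $\mathcal{Z}$ (taken closed under isomorphism) which is posetal (at most one morphism between any two of its objects), monocoreflective (the inclusion has a right adjoint $\mathsf{Z}$, the coreflector, with every counit component $\varepsilon_A\colon\mathsf{Z}(A)\to A$ a monomorphism), and such that $\mathsf{Z}(m)$ is an isomorphism for every monomorphism $m$ of $\mathcal{C}$. An arrow $f$ is inverted by $\mathsf{Z}$ if $\mathsf{Z}(f)$ is an isomorphism. $\mathcal{N}_{\mathcal{Z}}$ denotes the class of arrows of $\mathcal{C}$ factoring through an object of $\mathcal{Z}$. A $\mathcal{Z}$-kernel of $f\colon A\to B$ is an arrow $k\colon K\to A$ with $fk\in\mathcal{N}_{\mathcal{Z}}$ such that every $e\colon E\to A$ with $fe\in\mathcal{N}_{\mathcal{Z}}$ factors uniquely through $k$; $\mathcal{Z}$-cokernels are defined dually; an arrow "is a $\mathcal{Z}$-cokernel" if it is one of some arrow. A sequence $A\xrightarrow{f}B\xrightarrow{g}C$ is short $\mathcal{Z}$-exact if $f$ is a $\mathcal{Z}$-kernel of $g$ and $g$ is a $\mathcal{Z}$-cokernel of $f$. A $\mathcal{Z}$-torsion theory is a pair $(\mathcal{T},\mathcal{F})$ of full replete subcategories of $\mathcal{C}$ such that: $\mathcal{T}\cap\mathcal{F}=\mathcal{Z}$;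 every arrow $T\to F$ with $T\in\mathcal{T}$, $F\in\mathcal{F}$ lies in $\mathcal{N}_{\mathcal{Z}}$; for every $A\in\mathcal{C}$ there is a short $\mathcal{Z}$-exact sequence $\mathsf{T}(A)\xrightarrow{t_A}A\xrightarrow{\eta_A}\mathsf{F}(A)$ with $\mathsf{T}(A)\in\mathcal{T}$, $\mathsf{F}(A)\in\mathcal{F}$ (unique up to isomorphism). The assignment $\mathsf{F}$ extends to a functor $\mathcal{C}\to\mathcal{F}$ left adjoint to the inclusion, with unit $\eta$. Condition (M'): for every object $A$ of $\mathcal{C}$, $\mathsf{F}(\mathsf{T}(A))\cong\mathsf{Z}(\mathsf{F}(A))$. *)

theory Defs
  imports Main
begin

section \<open>Categories\<close>

text \<open>Composition is written in the usual (applicative) order: \<open>g \<cdot>\<^bsub>C\<^esub> f\<close> is \<open>g\<close> after \<open>f\<close>.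
  Objects and arrows form arbitrary sets in two arbitrary types; values of the operations outside
  these sets are irrelevant.\<close>

record ('o, 'a) cat =
  Obj :: "'o set"
  Arr :: "'a set"
  Dom :: "'a \<Rightarrow> 'o"
  Cod :: "'a \<Rightarrow> 'o"
  Ident :: "'o \<Rightarrow> 'a"
  Comp :: "'a \<Rightarrow> 'a \<Rightarrow> 'a"  (infixl "\<cdot>\<index>" 70)

definition hom :: "('o, 'a) cat \<Rightarrow> 'o \<Rightarrow> 'o \<Rightarrow> 'a set" where
  "hom C A B = {f \<in> Arr C. Dom C f = A \<and> Cod C f = B}"

locale category =
  fixes C :: "('o, 'a) cat" (structure)
  assumes dom_obj: "f \<in> Arr C \<Longrightarrow> Dom C f \<in> Obj C"
    and cod_obj: "f \<in> Arr C \<Longrightarrow> Cod C f \<in> Obj C"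
    and ident_hom: "A \<in> Obj C \<Longrightarrow> Ident C A \<in> hom C A A"
    and comp_hom: "f \<in> hom C A B \<Longrightarrow> g \<in> hom C B D \<Longrightarrow> g \<cdot> f \<in> hom C A D"
    and ident_left: "f \<in> hom C A B \<Longrightarrow> Ident C B \<cdot> f = f"
    and ident_right: "f \<in> hom C A B \<Longrightarrow> f \<cdot> Ident C A = f"
    and comp_assoc: "f \<in> hom C A B \<Longrightarrow> g \<in> hom C B D \<Longrightarrow> h \<in> hom C D E
      \<Longrightarrow> h \<cdot> (g \<cdot> f) = (h \<cdot> g) \<cdot> f"

definition is_iso :: "('o, 'a) cat \<Rightarrow> 'a \<Rightarrow> bool" where
  "is_iso C f \<longleftrightarrow> f \<in> Arr C \<and> (\<exists>g \<in> hom C (Cod C f) (Dom C f).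
     g \<cdot>\<^bsub>C\<^esub> f = Ident C (Dom C f) \<and> f \<cdot>\<^bsub>C\<^esub> g = Ident C (Cod C f))"

definition isomorphic :: "('o, 'a) cat \<Rightarrow> 'o \<Rightarrow> 'o \<Rightarrow> bool" where
  "isomorphic C A B \<longleftrightarrow> (\<exists>f \<in> hom C A B. is_iso C f)"

definition is_mono :: "('o, 'a) cat \<Rightarrow> 'a \<Rightarrow> bool" where
  "is_mono C m \<longleftrightarrow> m \<in> Arr C \<and> (\<forall>X. \<forall>u \<in> hom C X (Dom C m). \<forall>v \<in> hom C X (Dom C m).
     m \<cdot>\<^bsub>C\<^esub> u = m \<cdot>\<^bsub>C\<^esub> v \<longrightarrow> u = v)"

definition is_terminal :: "('o, 'a) cat \<Rightarrow> 'o \<Rightarrow> bool" where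
  "is_terminal C U \<longleftrightarrow> U \<in> Obj C \<and> (\<forall>A \<in> Obj C. \<exists>!f. f \<in> hom C A U)"

text \<open>\<open>is_pullback C f g P p q\<close>: the square \<open>f \<cdot> p = g \<cdot> q\<close> with vertex \<open>P\<close> is a pullback, so
  \<open>p\<close> is the pullback of \<open>g\<close> along \<open>f\<close>.\<close>

definition is_pullback :: "('o, 'a) cat \<Rightarrow> 'a \<Rightarrow> 'a \<Rightarrow> 'o \<Rightarrow> 'a \<Rightarrow> 'a \<Rightarrow> bool" where
  "is_pullback C f g P p q \<longleftrightarrow>
     f \<in> Arr C \<and> g \<in> Arr C \<and> Cod C f = Cod C g \<and>
     p \<in> hom C P (Dom C f) \<and> q \<in> hom C P (Dom C g) \<and> f \<cdot>\<^bsub>C\<^esub> p = g \<cdot>\<^bsub>C\<^esub> q \<and>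
     (\<forall>X. \<forall>u \<in> hom C X (Dom C f). \<forall>v \<in> hom C X (Dom C g). f \<cdot>\<^bsub>C\<^esub> u = g \<cdot>\<^bsub>C\<^esub> v \<longrightarrow>
        (\<exists>!h. h \<in> hom C X P \<and> p \<cdot>\<^bsub>C\<^esub> h = u \<and> q \<cdot>\<^bsub>C\<^esub> h = v))"

definition is_coequalizer :: "('o, 'a) cat \<Rightarrow> 'a \<Rightarrow> 'a \<Rightarrow> 'a \<Rightarrow> bool" where
  "is_coequalizer C u v e \<longleftrightarrow>
     u \<in> Arr C \<and> v \<in> Arr C \<and> e \<in> Arr C \<and>
     Dom C u = Dom C v \<and> Cod C u = Dom C e \<and> Cod C v = Dom C e \<and>
     e \<cdot>\<^bsub>C\<^esub> u = e \<cdot>\<^bsub>C\<^esub> v \<and>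
     (\<forall>X. \<forall>d \<in> hom C (Dom C e) X. d \<cdot>\<^bsub>C\<^esub> u = d \<cdot>\<^bsub>C\<^esub> v \<longrightarrow>
        (\<exists>!h. h \<in> hom C (Cod C e) X \<and> h \<cdot>\<^bsub>C\<^esub> e = d))"

definition is_regular_epi :: "('o, 'a) cat \<Rightarrow> 'a \<Rightarrow> bool" where
  "is_regular_epi C e \<longleftrightarrow> (\<exists>u v. is_coequalizer C u v e)"

text \<open>Finite limits are expressed, as usual, by a terminal object and pullbacks; a kernel pair of
  \<open>f\<close> is a pullback of \<open>f\<close> along itself.\<close>

definition finitely_complete :: "('o, 'a) cat \<Rightarrow> bool" where
  "finitely_complete C \<longleftrightarrow> (\<exists>U. is_terminal C U) \<and>
     (\<forall>f \<in> Arr C. \<forall>g \<in> Arr C. Cod C f = Cod C g \<longrightarrow> (\<exists>P p q. is_pullback C f g P p q))"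

definition regular :: "('o, 'a) cat \<Rightarrow> bool" where
  "regular C \<longleftrightarrow> finitely_complete C \<and>
     (\<forall>f P p q. is_pullback C f f P p q \<longrightarrow> (\<exists>e. is_coequalizer C p q e)) \<and>
     (\<forall>f g P p q. is_pullback C f g P p q \<and> is_regular_epi C g \<longrightarrow> is_regular_epi C p)"

definition is_section :: "('o, 'a) cat \<Rightarrow> 'a \<Rightarrow> 'a \<Rightarrow> bool" where
  "is_section C p s \<longleftrightarrow> p \<in> Arr C \<and> s \<in> hom C (Cod C p) (Dom C p) \<and>
     p \<cdot>\<^bsub>C\<^esub> s = Ident C (Cod C p)"

definition jointly_extremally_epi :: "('o, 'a) cat \<Rightarrow> 'a \<Rightarrow> 'a \<Rightarrow> bool" where
  "jointly_extremally_epi C g s \<longleftrightarrow> g \<in> Arr C \<and> s \<in> Arr C \<and> Cod C g = Cod C s \<and>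
     (\<forall>m. is_mono C m \<and> Cod C m = Cod C g \<and>
        (\<exists>u \<in> hom C (Dom C g) (Dom C m). m \<cdot>\<^bsub>C\<^esub> u = g) \<and>
        (\<exists>v \<in> hom C (Dom C s) (Dom C m). m \<cdot>\<^bsub>C\<^esub> v = s) \<longrightarrow> is_iso C m)"

definition protomodular :: "('o, 'a) cat \<Rightarrow> bool" where
  "protomodular C \<longleftrightarrow>
     (\<forall>p s f. is_section C p s \<and> f \<in> Arr C \<and> Cod C f = Cod C p \<longrightarrow>
        (\<exists>P p' g. is_pullback C f p P p' g)) \<and>
     (\<forall>p s f P p' g. is_section C p s \<and> is_pullback C f p P p' g \<longrightarrow>
        jointly_extremally_epi C g s)"

section \<open>Reflective and coreflective subcategories\<close>

text \<open>Full subcategories are given by their sets of objects.\<close>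

definition full_sub :: "('o, 'a) cat \<Rightarrow> 'o set \<Rightarrow> ('o, 'a) cat" where
  "full_sub C S = C\<lparr>Obj := S, Arr := {f \<in> Arr C. Dom C f \<in> S \<and> Cod C f \<in> S}\<rparr>"

definition replete :: "('o, 'a) cat \<Rightarrow> 'o set \<Rightarrow> bool" where
  "replete C S \<longleftrightarrow> S \<subseteq> Obj C \<and> (\<forall>A \<in> S. \<forall>B \<in> Obj C. isomorphic C A B \<longrightarrow> B \<in> S)"

record ('o, 'a, 'p, 'b) cat_functor =
  fobj :: "'o \<Rightarrow> 'p"
  farr :: "'a \<Rightarrow> 'b"

definition is_functor :: "('o, 'a) cat \<Rightarrow> ('p, 'b) cat \<Rightarrow> ('o, 'a, 'p, 'b) cat_functor \<Rightarrow> bool" where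
  "is_functor C D \<Phi> \<longleftrightarrow>
     (\<forall>A \<in> Obj C. fobj \<Phi> A \<in> Obj D) \<and>
     (\<forall>A B. \<forall>f \<in> hom C A B. farr \<Phi> f \<in> hom D (fobj \<Phi> A) (fobj \<Phi> B)) \<and>
     (\<forall>A \<in> Obj C. farr \<Phi> (Ident C A) = Ident D (fobj \<Phi> A)) \<and>
     (\<forall>A B E. \<forall>f \<in> hom C A B. \<forall>g \<in> hom C B E.
        farr \<Phi> (g \<cdot>\<^bsub>C\<^esub> f) = farr \<Phi> g \<cdot>\<^bsub>D\<^esub> farr \<Phi> f)"

text \<open>\<open>reflector C S \<Phi> \<eta>\<close>: the functor \<open>\<Phi>\<close> from \<open>C\<close> to the full subcategory on \<open>S\<close> is left adjoint
  to the inclusion, with unit \<open>\<eta>\<close> (a natural transformation with universal components). Dually,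
  \<open>coreflector C S \<Psi> \<epsilon>\<close>: \<open>\<Psi>\<close> is right adjoint to the inclusion, with counit \<open>\<epsilon>\<close>.\<close>

definition reflector ::
    "('o, 'a) cat \<Rightarrow> 'o set \<Rightarrow> ('o, 'a, 'o, 'a) cat_functor \<Rightarrow> ('o \<Rightarrow> 'a) \<Rightarrow> bool" where
  "reflector C S \<Phi> \<eta> \<longleftrightarrow>
     is_functor C (full_sub C S) \<Phi> \<and>
     (\<forall>A \<in> Obj C. \<eta> A \<in> hom C A (fobj \<Phi> A)) \<and>
     (\<forall>A B. \<forall>f \<in> hom C A B. farr \<Phi> f \<cdot>\<^bsub>C\<^esub> \<eta> A = \<eta> B \<cdot>\<^bsub>C\<^esub> f) \<and>
     (\<forall>A \<in> Obj C. \<forall>X \<in> S. \<forall>f \<in> hom C A X. \<exists>!h. h \<in> hom C (fobj \<Phi> A) X \<and> h \<cdot>\<^bsub>C\<^esub> \<eta> A = f)"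

definition coreflector ::
    "('o, 'a) cat \<Rightarrow> 'o set \<Rightarrow> ('o, 'a, 'o, 'a) cat_functor \<Rightarrow> ('o \<Rightarrow> 'a) \<Rightarrow> bool" where
  "coreflector C S \<Psi> \<epsilon> \<longleftrightarrow>
     is_functor C (full_sub C S) \<Psi> \<and>
     (\<forall>A \<in> Obj C. \<epsilon> A \<in> hom C (fobj \<Psi> A) A) \<and>
     (\<forall>A B. \<forall>f \<in> hom C A B. \<epsilon> B \<cdot>\<^bsub>C\<^esub> farr \<Psi> f = f \<cdot>\<^bsub>C\<^esub> \<epsilon> A) \<and>
     (\<forall>A \<in> Obj C. \<forall>X \<in> S. \<forall>f \<in> hom C X A. \<exists>!h. h \<in> hom C X (fobj \<Psi> A) \<and> \<epsilon> A \<cdot>\<^bsub>C\<^esub> h = f)"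

section \<open>Classes of zero objects and torsion theories\<close>

definition posetal :: "('o, 'a) cat \<Rightarrow> 'o set \<Rightarrow> bool" where
  "posetal C Z \<longleftrightarrow> (\<forall>A \<in> Z. \<forall>B \<in> Z. \<forall>f \<in> hom C A B. \<forall>g \<in> hom C A B. f = g)"

definition class_of_zero_objects ::
    "('o, 'a) cat \<Rightarrow> 'o set \<Rightarrow> ('o, 'a, 'o, 'a) cat_functor \<Rightarrow> ('o \<Rightarrow> 'a) \<Rightarrow> bool" where
  "class_of_zero_objects C Z \<Psi> \<epsilon> \<longleftrightarrow>
     replete C Z \<and> posetal C Z \<and>
     coreflector C Z \<Psi> \<epsilon> \<and> (\<forall>A \<in> Obj C. is_mono C (\<epsilon> A)) \<and>
     (\<forall>m. is_mono C m \<longrightarrow> is_iso C (farr \<Psi> m))"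

definition null_arrows :: "('o, 'a) cat \<Rightarrow> 'o set \<Rightarrow> 'a set" where
  "null_arrows C Z = {f \<in> Arr C. \<exists>X \<in> Z. \<exists>u \<in> hom C (Dom C f) X. \<exists>v \<in> hom C X (Cod C f).
     f = v \<cdot>\<^bsub>C\<^esub> u}"

definition is_zkernel :: "('o, 'a) cat \<Rightarrow> 'o set \<Rightarrow> 'a \<Rightarrow> 'a \<Rightarrow> bool" where
  "is_zkernel C Z k f \<longleftrightarrow>
     f \<in> Arr C \<and> k \<in> Arr C \<and> Cod C k = Dom C f \<and> f \<cdot>\<^bsub>C\<^esub> k \<in> null_arrows C Z \<and>
     (\<forall>E. \<forall>e \<in> hom C E (Dom C f). f \<cdot>\<^bsub>C\<^esub> e \<in> null_arrows C Z \<longrightarrow>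
        (\<exists>!h. h \<in> hom C E (Dom C k) \<and> k \<cdot>\<^bsub>C\<^esub> h = e))"

definition is_zcokernel :: "('o, 'a) cat \<Rightarrow> 'o set \<Rightarrow> 'a \<Rightarrow> 'a \<Rightarrow> bool" where
  "is_zcokernel C Z q f \<longleftrightarrow>
     f \<in> Arr C \<and> q \<in> Arr C \<and> Dom C q = Cod C f \<and> q \<cdot>\<^bsub>C\<^esub> f \<in> null_arrows C Z \<and>
     (\<forall>E. \<forall>e \<in> hom C (Cod C f) E. e \<cdot>\<^bsub>C\<^esub> f \<in> null_arrows C Z \<longrightarrow>
        (\<exists>!h. h \<in> hom C (Cod C q) E \<and> h \<cdot>\<^bsub>C\<^esub> q = e))"

definition short_zexact :: "('o, 'a) cat \<Rightarrow> 'o set \<Rightarrow> 'a \<Rightarrow> 'a \<Rightarrow> bool" where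
  "short_zexact C Z f g \<longleftrightarrow> is_zkernel C Z f g \<and> is_zcokernel C Z g f"

definition torsion_sequence ::
    "('o, 'a) cat \<Rightarrow> 'o set \<Rightarrow> 'o set \<Rightarrow> 'o set \<Rightarrow> 'o \<Rightarrow> 'o \<Rightarrow> 'a \<Rightarrow> 'o \<Rightarrow> 'a \<Rightarrow> bool" where
  "torsion_sequence C Z T F A TA t FA e \<longleftrightarrow>
     TA \<in> T \<and> FA \<in> F \<and> t \<in> hom C TA A \<and> e \<in> hom C A FA \<and> short_zexact C Z t e"

definition torsion_theory :: "('o, 'a) cat \<Rightarrow> 'o set \<Rightarrow> 'o set \<Rightarrow> 'o set \<Rightarrow> bool" where
  "torsion_theory C Z T F \<longleftrightarrow>
     replete C T \<and> replete C F \<and> T \<inter> F = Z \<and>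
     (\<forall>X \<in> T. \<forall>Y \<in> F. hom C X Y \<subseteq> null_arrows C Z) \<and>
     (\<forall>A \<in> Obj C. \<exists>TA t FA e. torsion_sequence C Z T F A TA t FA e)"

text \<open>\<open>\<Theta>\<close> and \<open>t\<close> choose the torsion parts, \<open>\<Phi>\<close> is the associated reflector to \<open>F\<close>: it extends
  the choice of torsion-free parts, and its unit \<open>\<eta>\<close> consists of the chosen Z-cokernels. That
  such data exist for every torsion theory is shown in \<open>associated_reflector_exists\<close> below.\<close>

definition associated_reflector ::
    "('o, 'a) cat \<Rightarrow> 'o set \<Rightarrow> 'o set \<Rightarrow> 'o set \<Rightarrow> ('o \<Rightarrow> 'o) \<Rightarrow> ('o \<Rightarrow> 'a) \<Rightarrow>
     ('o, 'a, 'o, 'a) cat_functor \<Rightarrow> ('o \<Rightarrow> 'a) \<Rightarrow> bool" where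
  "associated_reflector C Z T F \<Theta> t \<Phi> \<eta> \<longleftrightarrow>
     (\<forall>A \<in> Obj C. torsion_sequence C Z T F A (\<Theta> A) (t A) (fobj \<Phi> A) (\<eta> A)) \<and>
     reflector C F \<Phi> \<eta>"

definition condition_M' ::
    "('o, 'a) cat \<Rightarrow> ('o \<Rightarrow> 'o) \<Rightarrow> ('o, 'a, 'o, 'a) cat_functor \<Rightarrow>
     ('o, 'a, 'o, 'a) cat_functor \<Rightarrow> bool" where
  "condition_M' C \<Theta> \<Phi> \<Psi> \<longleftrightarrow>
     (\<forall>A \<in> Obj C. isomorphic C (fobj \<Phi> (\<Theta> A)) (fobj \<Psi> (fobj \<Phi> A)))"

lemma hom_full_sub:
  "hom (full_sub C S) A B = (if A \<in> S \<and> B \<in> S then hom C A B else {})"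
  by (auto simp: hom_def full_sub_def)

lemma full_sub_simps [simp]:
  "Obj (full_sub C S) = S" "Ident (full_sub C S) = Ident C" "Comp (full_sub C S) = Comp C"
  by (simp_all add: full_sub_def)

theorem associated_reflector_exists:
  assumes "category C" "torsion_theory C Z T F"
  shows "\<exists>\<Theta> t \<Phi> \<eta>. associated_reflector C Z T F \<Theta> t \<Phi> \<eta>"
proof -
  interpret category C by fact
  have F: "F \<subseteq> Obj C" using assms(2) by (simp add: torsion_theory_def replete_def)
  have "\<forall>A. \<exists>TA t FA e. A \<in> Obj C \<longrightarrow> torsion_sequence C Z T F A TA t FA e"
    using assms(2) by (auto simp: torsion_theory_def)
  then obtain \<Theta> t R \<eta>
    where seq: "\<And>A. A \<in> Obj C \<Longrightarrow> torsion_sequence C Z T F A (\<Theta> A) (t A) (R A) (\<eta> A)"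
    by metis
  have \<eta>: "\<eta> A \<in> hom C A (R A)" "R A \<in> F" if "A \<in> Obj C" for A
    using seq[OF that] by (auto simp: torsion_sequence_def)
  have univ: "\<exists>!h. h \<in> hom C (R A) X \<and> h \<cdot>\<^bsub>C\<^esub> \<eta> A = f"
    if "A \<in> Obj C" "X \<in> F" "f \<in> hom C A X" for A X f
  proof -
    have t: "t A \<in> hom C (\<Theta> A) A" "\<Theta> A \<in> T" "is_zcokernel C Z (\<eta> A) (t A)"
      using seq[OF that(1)] by (auto simp: torsion_sequence_def short_zexact_def)
    have "f \<cdot>\<^bsub>C\<^esub> t A \<in> hom C (\<Theta> A) X" using comp_hom t that by blast
    then have "f \<cdot>\<^bsub>C\<^esub> t A \<in> null_arrows C Z"
      using assms(2) t(2) that(2) by (auto simp: torsion_theory_def)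
    moreover have "Cod C (t A) = A" "Cod C (\<eta> A) = R A"
      using t(1) \<eta>(1)[OF that(1)] by (auto simp: hom_def)
    ultimately show ?thesis
      using t(3) that(3) unfolding is_zcokernel_def by metis
  qed
  define P where "P f h \<longleftrightarrow> h \<in> hom C (R (Dom C f)) (R (Cod C f)) \<and>
      h \<cdot>\<^bsub>C\<^esub> \<eta> (Dom C f) = \<eta> (Cod C f) \<cdot>\<^bsub>C\<^esub> f" for f h
  define \<Phi> where "\<Phi> = \<lparr>fobj = R, farr = \<lambda>f. THE h. P f h\<rparr>"
  have P: "\<exists>!h. P f h" if "f \<in> Arr C" for f
    unfolding P_def
  proof (rule univ)
    show "Dom C f \<in> Obj C" "R (Cod C f) \<in> F" using that dom_obj cod_obj \<eta> by auto
    have "f \<in> hom C (Dom C f) (Cod C f)" using that by (simp add: hom_def)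
    then show "\<eta> (Cod C f) \<cdot>\<^bsub>C\<^esub> f \<in> hom C (Dom C f) (R (Cod C f))"
      using comp_hom \<eta>(1) cod_obj that by blast
  qed
  have the: "P f (farr \<Phi> f)" if "f \<in> Arr C" for f
    using theI'[OF P[OF that]] by (simp add: \<Phi>_def)
  have unq: "farr \<Phi> f = h" if "P f h" "f \<in> Arr C" for f h
    using P[OF that(2)] the[OF that(2)] that(1) by (metis (no_types))
  have nat: "farr \<Phi> f \<in> hom C (R A) (R B)" "farr \<Phi> f \<cdot>\<^bsub>C\<^esub> \<eta> A = \<eta> B \<cdot>\<^bsub>C\<^esub> f"
    if "f \<in> hom C A B" for f A B
    using that the[of f] by (auto simp: P_def hom_def)
  have id: "farr \<Phi> (Ident C A) = Ident C (R A)" if A: "A \<in> Obj C" for A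
  proof -
    have i: "Ident C A \<in> hom C A A" using A ident_hom by blast
    have "R A \<in> Obj C" using \<eta>(2)[OF A] F by auto
    then have "P (Ident C A) (Ident C (R A))"
      using i ident_hom[of "R A"] ident_left[OF \<eta>(1)[OF A]] ident_right[OF \<eta>(1)[OF A]]
      by (simp add: P_def hom_def)
    then show ?thesis using i by (intro unq) (auto simp: hom_def)
  qed
  have comp: "farr \<Phi> (g \<cdot>\<^bsub>C\<^esub> f) = farr \<Phi> g \<cdot>\<^bsub>C\<^esub> farr \<Phi> f"
    if f: "f \<in> hom C A B" and g: "g \<in> hom C B E" for f g A B E
  proof -
    have gf: "g \<cdot>\<^bsub>C\<^esub> f \<in> hom C A E" using f g comp_hom by blast
    have ob: "A \<in> Obj C" "B \<in> Obj C" "E \<in> Obj C"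
      using f g dom_obj cod_obj by (auto simp: hom_def)
    have 1: "farr \<Phi> g \<cdot>\<^bsub>C\<^esub> farr \<Phi> f \<in> hom C (R A) (R E)"
      using nat(1)[OF f] nat(1)[OF g] comp_hom by blast
    have "(farr \<Phi> g \<cdot>\<^bsub>C\<^esub> farr \<Phi> f) \<cdot>\<^bsub>C\<^esub> \<eta> A = farr \<Phi> g \<cdot>\<^bsub>C\<^esub> (\<eta> B \<cdot>\<^bsub>C\<^esub> f)"
      using comp_assoc[OF \<eta>(1)[OF ob(1)] nat(1)[OF f] nat(1)[OF g]] nat(2)[OF f] by simp
    also have "\<dots> = (\<eta> E \<cdot>\<^bsub>C\<^esub> g) \<cdot>\<^bsub>C\<^esub> f"
      using comp_assoc[OF f \<eta>(1)[OF ob(2)] nat(1)[OF g]] nat(2)[OF g] by simp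
    also have "\<dots> = \<eta> E \<cdot>\<^bsub>C\<^esub> (g \<cdot>\<^bsub>C\<^esub> f)"
      using comp_assoc[OF f g \<eta>(1)[OF ob(3)]] by simp
    finally have "P (g \<cdot>\<^bsub>C\<^esub> f) (farr \<Phi> g \<cdot>\<^bsub>C\<^esub> farr \<Phi> f)"
      using 1 gf unfolding P_def hom_def by auto
    then show ?thesis using gf by (intro unq) (auto simp: hom_def)
  qed
  have R: "fobj \<Phi> = R" by (simp add: \<Phi>_def)
  have F': "f \<in> hom C A B \<Longrightarrow> R A \<in> F \<and> R B \<in> F" for f A B
    using dom_obj cod_obj \<eta>(2) by (auto simp: hom_def)
  have "is_functor C (full_sub C F) \<Phi>"
    unfolding is_functor_def R hom_full_sub full_sub_simps
  proof (intro conjI ballI allI)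
    fix A B f assume "f \<in> hom C A B"
    then show "farr \<Phi> f \<in> (if R A \<in> F \<and> R B \<in> F then hom C (R A) (R B) else {})"
      using F' nat(1) by simp
  qed (rule \<eta>(2) id comp; assumption)+
  then have "reflector C F \<Phi> \<eta>"
    unfolding reflector_def R by (intro conjI ballI allI \<eta>(1) nat(2) univ)
  then show ?thesis using seq R unfolding associated_reflector_def
    by (intro exI[of _ \<Theta>] exI[of _ t] exI[of _ \<Phi>] exI[of _ \<eta>]) simp
qed

end

theory Submission
  imports Defs
begin

text \<open>Since \<open>\<eta> B\<close> is a Z-cokernel and the coreflector inverts the mono part of its image
  factorization, it is a regular epimorphism, and so is its pullback \<open>p\<close> along \<open>f\<close>. As the
  coreflector inverts \<open>f\<close>, the object \<open>\<Theta> B\<close> also underlies the Z-kernel \<open>k\<close> of \<open>p\<close>. Condition (M')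
  says that \<open>\<Theta> B\<close> has the coreflection of \<open>A\<close> as its torsion-free reflection, so every null arrow
  out of \<open>\<Theta> B\<close> factors through it. Pulling the kernel pair of \<open>p\<close> back along \<open>k\<close> and using
  protomodularity, \<open>\<eta> P\<close> coequalizes the kernel pair of \<open>p\<close>, hence factors through \<open>p\<close>; this
  factorization inverts the comparison between the reflection of \<open>P\<close> and \<open>A\<close>.\<close>

section \<open>Hom-sets, isomorphisms and monomorphisms\<close>

lemma homI: "f \<in> Arr C \<Longrightarrow> Dom C f = A \<Longrightarrow> Cod C f = B \<Longrightarrow> f \<in> hom C A B"
  by (simp add: hom_def)

lemma homD: "f \<in> hom C A B \<Longrightarrow> f \<in> Arr C \<and> Dom C f = A \<and> Cod C f = B"
  by (simp add: hom_def)

context category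
begin

lemma hom_objD:
  assumes "f \<in> hom C A B"
  shows "A \<in> Obj C" "B \<in> Obj C"
  using assms dom_obj cod_obj by (auto simp: hom_def)

lemma isoI:
  assumes "f \<in> hom C A B" "g \<in> hom C B A" "g \<cdot> f = Ident C A" "f \<cdot> g = Ident C B"
  shows "is_iso C f"
  using assms by (auto simp: is_iso_def hom_def)

lemma isoE:
  assumes "is_iso C f" "f \<in> hom C A B"
  obtains g where "g \<in> hom C B A" "g \<cdot> f = Ident C A" "f \<cdot> g = Ident C B"
  using assms by (auto simp: is_iso_def hom_def)

lemma iso_comp:
  assumes f: "f \<in> hom C A B" "is_iso C f" and g: "g \<in> hom C B D" "is_iso C g"
  shows "is_iso C (g \<cdot> f)"
proof -
  obtain f' where f': "f' \<in> hom C B A" "f' \<cdot> f = Ident C A" "f \<cdot> f' = Ident C B"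
    using f by (blast elim: isoE)
  obtain g' where g': "g' \<in> hom C D B" "g' \<cdot> g = Ident C B" "g \<cdot> g' = Ident C D"
    using g by (blast elim: isoE)
  have fg': "f' \<cdot> g' \<in> hom C D A" and gf: "g \<cdot> f \<in> hom C A D" using f f' g g' comp_hom by blast+
  have "(f' \<cdot> g') \<cdot> (g \<cdot> f) = f' \<cdot> ((g' \<cdot> g) \<cdot> f)"
    using comp_assoc[OF gf g'(1) f'(1)] comp_assoc[OF f(1) g(1) g'(1)] by simp
  then have 1: "(f' \<cdot> g') \<cdot> (g \<cdot> f) = Ident C A" using f' g' ident_left[OF f(1)] by simp
  have "(g \<cdot> f) \<cdot> (f' \<cdot> g') = g \<cdot> ((f \<cdot> f') \<cdot> g')"
    using comp_assoc[OF fg' f(1) g(1)] comp_assoc[OF g'(1) f'(1) f(1)] by simp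
  then have "(g \<cdot> f) \<cdot> (f' \<cdot> g') = Ident C D" using f' g' ident_left[OF g'(1)] by simp
  then show ?thesis using isoI gf fg' 1 by blast
qed

lemma mono_cancel:
  assumes "is_mono C m" "m \<in> hom C A B" "u \<in> hom C X A" "v \<in> hom C X A" "m \<cdot> u = m \<cdot> v"
  shows "u = v"
  using assms by (auto simp: is_mono_def hom_def)

lemma mono_comp_iso:
  assumes m: "is_mono C m" "m \<in> hom C B D" and i: "is_iso C i" "i \<in> hom C A B"
  shows "is_mono C (m \<cdot> i)"
proof -
  obtain j where j: "j \<in> hom C B A" "j \<cdot> i = Ident C A"
    using i by (blast elim: isoE)
  have mi: "m \<cdot> i \<in> hom C A D" using i m comp_hom by blast
  have "u = v" if u: "u \<in> hom C X A" and v: "v \<in> hom C X A" and eq: "(m \<cdot> i) \<cdot> u = (m \<cdot> i) \<cdot> v"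
    for X u v
  proof -
    have "m \<cdot> (i \<cdot> u) = m \<cdot> (i \<cdot> v)"
      using eq comp_assoc[OF u i(2) m(2)] comp_assoc[OF v i(2) m(2)] by simp
    then have "i \<cdot> u = i \<cdot> v"
      using mono_cancel[OF m] comp_hom[OF u i(2)] comp_hom[OF v i(2)] by blast
    then show "u = v"
      using comp_assoc[OF u i(2) j(1)] comp_assoc[OF v i(2) j(1)] j(2) ident_left[OF u]
        ident_left[OF v] by metis
  qed
  then show ?thesis using homD[OF mi] unfolding is_mono_def by simp
qed

section \<open>Pullbacks\<close>

lemma pullbackD:
  assumes "is_pullback C f g P p q" "f \<in> hom C A D" "g \<in> hom C B D"
  shows "p \<in> hom C P A" "q \<in> hom C P B" "f \<cdot> p = g \<cdot> q"
proof -
  have "Dom C f = A" "Dom C g = B" using assms(2,3) by (auto simp: hom_def)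
  then show "p \<in> hom C P A" "q \<in> hom C P B" "f \<cdot> p = g \<cdot> q"
    using assms(1) unfolding is_pullback_def by blast+
qed

lemma pullback_lift:
  assumes "is_pullback C f g P p q" "f \<in> hom C A D" "g \<in> hom C B D"
    and "u \<in> hom C X A" "v \<in> hom C X B" "f \<cdot> u = g \<cdot> v"
  obtains h where "h \<in> hom C X P" "p \<cdot> h = u" "q \<cdot> h = v"
proof -
  have "Dom C f = A" "Dom C g = B" using assms(2,3) by (auto simp: hom_def)
  then have "\<exists>!h. h \<in> hom C X P \<and> p \<cdot> h = u \<and> q \<cdot> h = v"
    using assms unfolding is_pullback_def by blast
  then show ?thesis using that by blast
qed

lemma pullback_cancel:
  assumes pb: "is_pullback C f g P p q" and f: "f \<in> hom C A D" and g: "g \<in> hom C B D"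
    and x: "x \<in> hom C X P" and y: "y \<in> hom C X P" and eq: "p \<cdot> x = p \<cdot> y" "q \<cdot> x = q \<cdot> y"
  shows "x = y"
proof -
  note pq = pullbackD[OF pb f g]
  have "f \<cdot> (p \<cdot> x) = g \<cdot> (q \<cdot> x)"
    using comp_assoc[OF x pq(1) f] comp_assoc[OF x pq(2) g] pq(3) by simp
  moreover have "Dom C f = A" "Dom C g = B" using f g by (auto simp: hom_def)
  ultimately have "\<exists>!h. h \<in> hom C X P \<and> p \<cdot> h = p \<cdot> x \<and> q \<cdot> h = q \<cdot> x"
    using pb comp_hom[OF x pq(1)] comp_hom[OF x pq(2)] unfolding is_pullback_def by blast
  then show ?thesis using x y eq by (metis (no_types))
qed

lemma pullback_exists:
  assumes "finitely_complete C" "f \<in> hom C A D" "g \<in> hom C B D"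
  obtains P p q where "is_pullback C f g P p q"
  using assms unfolding finitely_complete_def hom_def by force

section \<open>Coequalizers and regular epimorphisms\<close>

lemma coequalizerD:
  assumes "is_coequalizer C u v e" "e \<in> hom C A D"
  shows "e \<cdot> u = e \<cdot> v" "u \<in> hom C (Dom C u) A" "v \<in> hom C (Dom C u) A"
proof -
  have "Dom C e = A" using assms(2) by (auto simp: hom_def)
  then show "e \<cdot> u = e \<cdot> v" "u \<in> hom C (Dom C u) A" "v \<in> hom C (Dom C u) A"
    using assms(1) unfolding is_coequalizer_def by (auto intro: homI)
qed

lemma coequalizer_factor:
  assumes "is_coequalizer C u v e" "e \<in> hom C A D" "d \<in> hom C A X" "d \<cdot> u = d \<cdot> v"
  obtains h where "h \<in> hom C D X" "h \<cdot> e = d"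
proof -
  have "Dom C e = A" "Cod C e = D" using assms(2) by (auto simp: hom_def)
  then have "\<exists>!h. h \<in> hom C D X \<and> h \<cdot> e = d"
    using assms(1,3,4) unfolding is_coequalizer_def by blast
  then show ?thesis using that by blast
qed

lemma regular_epi_cancel:
  assumes "is_regular_epi C e" and e: "e \<in> hom C A B" and x: "x \<in> hom C B X"
    and y: "y \<in> hom C B X" and eq: "x \<cdot> e = y \<cdot> e"
  shows "x = y"
proof -
  obtain u v where uv: "is_coequalizer C u v e" using assms by (auto simp: is_regular_epi_def)
  note * = coequalizerD[OF uv e]
  have "(x \<cdot> e) \<cdot> u = (x \<cdot> e) \<cdot> v"
    using comp_assoc[OF *(2) e x] comp_assoc[OF *(3) e x] *(1) by simp
  then have "\<exists>!h. h \<in> hom C B X \<and> h \<cdot> e = x \<cdot> e"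
    using uv comp_hom[OF e x] homD[OF e] unfolding is_coequalizer_def by metis
  then show ?thesis using x y eq by (metis (no_types))
qed

text \<open>The pair that \<open>e\<close> coequalizes need not be its kernel pair, but it factors
  through the kernel pair by \<open>w\<close>; so \<open>h\<close>, identifying the legs of the
  latter, identifies that pair as well.\<close>

lemma regular_epi_factor:
  assumes "is_regular_epi C e" and e: "e \<in> hom C A B" and pb: "is_pullback C e e R r1 r2"
    and h: "h \<in> hom C A X" and eq: "h \<cdot> r1 = h \<cdot> r2"
  obtains g where "g \<in> hom C B X" "g \<cdot> e = h"
proof -
  obtain u v where uv: "is_coequalizer C u v e" using assms by (auto simp: is_regular_epi_def)
  note * = coequalizerD[OF uv e] and r = pullbackD[OF pb e e]
  obtain w where w: "w \<in> hom C (Dom C u) R" "r1 \<cdot> w = u" "r2 \<cdot> w = v"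
    using pullback_lift[OF pb e e *(2,3,1)] by blast
  have "h \<cdot> u = h \<cdot> v"
    using comp_assoc[OF w(1) r(1) h] comp_assoc[OF w(1) r(2) h] w eq by simp
  then show ?thesis using coequalizer_factor[OF uv e h] that by blast
qed

section \<open>Equalizers and joint epimorphy\<close>

text \<open>Finite limits are given as a terminal object and pullbacks, so the equalizer is built
  from these: \<open>Q\<close> is the product of \<open>X\<close> with itself, a pullback over the
  terminal object, and \<open>m\<close> is the pullback of the diagonal \<open>\<delta>\<close>
  along the pairing \<open>c\<close> of \<open>a\<close> and \<open>b\<close>.\<close>

lemma equalizer_exists:
  assumes fc: "finitely_complete C" and a: "a \<in> hom C R X" and b: "b \<in> hom C R X"
  obtains E m where "is_mono C m" "m \<in> hom C E R" "a \<cdot> m = b \<cdot> m"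
    "\<And>Y x. x \<in> hom C Y R \<Longrightarrow> a \<cdot> x = b \<cdot> x \<Longrightarrow> \<exists>y \<in> hom C Y E. m \<cdot> y = x"
proof -
  obtain U where U: "is_terminal C U" using fc by (auto simp: finitely_complete_def)
  obtain \<tau> where \<tau>: "\<tau> \<in> hom C X U"
    using U hom_objD[OF a] unfolding is_terminal_def by blast
  have term_eq: "x = y" if "x \<in> hom C Y U" "y \<in> hom C Y U" for x y Y
    using U that hom_objD[OF that(1)] unfolding is_terminal_def by blast
  obtain Q \<pi>1 \<pi>2 where Q: "is_pullback C \<tau> \<tau> Q \<pi>1 \<pi>2" using pullback_exists[OF fc \<tau> \<tau>] .
  note \<pi> = pullbackD[OF Q \<tau> \<tau>] and cancel = pullback_cancel[OF Q \<tau> \<tau>]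
  have i: "Ident C X \<in> hom C X X" using ident_hom hom_objD[OF a] by blast
  obtain \<delta> where \<delta>: "\<delta> \<in> hom C X Q" "\<pi>1 \<cdot> \<delta> = Ident C X" "\<pi>2 \<cdot> \<delta> = Ident C X"
    using pullback_lift[OF Q \<tau> \<tau> i i] by blast
  obtain c where c: "c \<in> hom C R Q" "\<pi>1 \<cdot> c = a" "\<pi>2 \<cdot> c = b"
    using pullback_lift[OF Q \<tau> \<tau> a b] term_eq comp_hom[OF a \<tau>] comp_hom[OF b \<tau>] by blast
  obtain E m n where E: "is_pullback C c \<delta> E m n" using pullback_exists[OF fc c(1) \<delta>(1)] .
  note mn = pullbackD[OF E c(1) \<delta>(1)]
  have am: "a \<cdot> m = n"
    using comp_assoc[OF mn(1) c(1) \<pi>(1)] comp_assoc[OF mn(2) \<delta>(1) \<pi>(1)] mn(3) c \<delta>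
      ident_left[OF mn(2)] by simp
  have bm: "b \<cdot> m = n"
    using comp_assoc[OF mn(1) c(1) \<pi>(2)] comp_assoc[OF mn(2) \<delta>(1) \<pi>(2)] mn(3) c \<delta>
      ident_left[OF mn(2)] by simp
  \<comment> \<open>The other projection is \<open>n = a \<cdot> m\<close>, so \<open>m\<close>
    alone determines arrows into the pullback.\<close>
  have "v = w" if v: "v \<in> hom C Y E" and w: "w \<in> hom C Y E" and eq: "m \<cdot> v = m \<cdot> w" for Y v w
  proof -
    have "n \<cdot> v = n \<cdot> w"
      using comp_assoc[OF v mn(1) a] comp_assoc[OF w mn(1) a] am eq by simp
    then show "v = w" using pullback_cancel[OF E c(1) \<delta>(1) v w eq] by simp
  qed
  then have mono: "is_mono C m" using homD[OF mn(1)] unfolding is_mono_def by simp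
  have "\<exists>y \<in> hom C Y E. m \<cdot> y = x" if x: "x \<in> hom C Y R" and eq: "a \<cdot> x = b \<cdot> x" for Y x
  proof -
    have ax: "a \<cdot> x \<in> hom C Y X" using comp_hom[OF x a] .
    have "c \<cdot> x = \<delta> \<cdot> (a \<cdot> x)"
    proof (rule cancel)
      show "c \<cdot> x \<in> hom C Y Q" "\<delta> \<cdot> (a \<cdot> x) \<in> hom C Y Q"
        using comp_hom x c ax \<delta> by blast+
      show "\<pi>1 \<cdot> (c \<cdot> x) = \<pi>1 \<cdot> (\<delta> \<cdot> (a \<cdot> x))"
        using comp_assoc[OF x c(1) \<pi>(1)] comp_assoc[OF ax \<delta>(1) \<pi>(1)] c \<delta> ident_left[OF ax] by simp
      show "\<pi>2 \<cdot> (c \<cdot> x) = \<pi>2 \<cdot> (\<delta> \<cdot> (a \<cdot> x))"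
        using comp_assoc[OF x c(1) \<pi>(2)] comp_assoc[OF ax \<delta>(1) \<pi>(2)] c \<delta> ident_left[OF ax] eq
        by simp
    qed
    then show ?thesis using pullback_lift[OF E c(1) \<delta>(1) x ax] by blast
  qed
  then show ?thesis using that mono mn(1) am bm by simp
qed

text \<open>The equalizer of \<open>a\<close> and \<open>b\<close> is a monomorphism through which
  both \<open>g\<close> and \<open>s\<close> factor; extremality makes it invertible.\<close>

lemma jointly_extremally_epi_cancel:
  assumes fc: "finitely_complete C" and je: "jointly_extremally_epi C g s"
    and g: "g \<in> hom C A R" and s: "s \<in> hom C B R"
    and a: "a \<in> hom C R X" and b: "b \<in> hom C R X"
    and eq: "a \<cdot> g = b \<cdot> g" "a \<cdot> s = b \<cdot> s"
  shows "a = b"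
proof -
  obtain E m where m: "is_mono C m" "m \<in> hom C E R" "a \<cdot> m = b \<cdot> m"
    and lift: "\<And>Y x. x \<in> hom C Y R \<Longrightarrow> a \<cdot> x = b \<cdot> x \<Longrightarrow> \<exists>y \<in> hom C Y E. m \<cdot> y = x"
    using equalizer_exists[OF fc a b] by metis
  have "is_iso C m"
    using je m(1) lift[OF g eq(1)] lift[OF s eq(2)] homD[OF m(2)] homD[OF g] homD[OF s]
    unfolding jointly_extremally_epi_def by blast
  then obtain n where n: "n \<in> hom C R E" "m \<cdot> n = Ident C R" using m(2) by (blast elim: isoE)
  then show ?thesis
    using comp_assoc[OF n(1) m(2) a] comp_assoc[OF n(1) m(2) b] m(3) ident_right[OF a]
      ident_right[OF b] by simp
qed

section \<open>Image factorization in a regular category\<close>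

text \<open>\<open>e\<close> is the coequalizer of the kernel pair of \<open>g\<close>. That the
  induced \<open>m\<close> is monic rests on pullback stability of regular epimorphisms, which lets
  arrows into \<open>I\<close> be lifted to \<open>A\<close> after passing to a cover.\<close>

lemma image_factorization:
  assumes "regular C" and g: "g \<in> hom C A B"
  obtains R r1 r2 I e m where "is_pullback C g g R r1 r2" "is_coequalizer C r1 r2 e"
    "e \<in> hom C A I" "m \<in> hom C I B" "m \<cdot> e = g" "is_mono C m"
proof -
  have fc: "finitely_complete C"
    and coeq: "\<And>f P p q. is_pullback C f f P p q \<Longrightarrow> \<exists>e. is_coequalizer C p q e"
    and stable: "\<And>f g P p q. is_pullback C f g P p q \<Longrightarrow> is_regular_epi C g \<Longrightarrow> is_regular_epi C p"
    using assms(1) unfolding regular_def by blast+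
  obtain R r1 r2 where R: "is_pullback C g g R r1 r2" using pullback_exists[OF fc g g] .
  note r = pullbackD[OF R g g]
  obtain e where ce: "is_coequalizer C r1 r2 e" using coeq[OF R] by blast
  define I where "I = Cod C e"
  have e: "e \<in> hom C A I" using ce homD[OF r(1)] by (auto simp: is_coequalizer_def hom_def I_def)
  obtain m where m: "m \<in> hom C I B" "m \<cdot> e = g" using coequalizer_factor[OF ce e g r(3)] .
  have re: "is_regular_epi C e" using ce by (auto simp: is_regular_epi_def)
  have "x = y" if x: "x \<in> hom C X I" and y: "y \<in> hom C X I" and eq: "m \<cdot> x = m \<cdot> y" for X x y
  proof -
    \<comment> \<open>Pulling \<open>e\<close> back along \<open>x\<close>, then along
      \<open>y \<cdot> c1\<close>, covers \<open>X\<close> by \<open>X2\<close>, over which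
      \<open>x\<close> and \<open>y\<close> lift to \<open>A\<close> as \<open>b1 \<cdot> c2\<close>
      and \<open>b2\<close>.\<close>
    obtain X1 c1 b1 where X1: "is_pullback C x e X1 c1 b1" using pullback_exists[OF fc x e] .
    note c1 = pullbackD[OF X1 x e]
    have yc1: "y \<cdot> c1 \<in> hom C X1 I" using comp_hom[OF c1(1) y] .
    obtain X2 c2 b2 where X2: "is_pullback C (y \<cdot> c1) e X2 c2 b2" using pullback_exists[OF fc yc1 e] .
    note c2 = pullbackD[OF X2 yc1 e]
    have h: "b1 \<cdot> c2 \<in> hom C X2 A" "x \<cdot> c1 \<in> hom C X1 I" using comp_hom c1 c2 x by blast+
    have xe: "(x \<cdot> c1) \<cdot> c2 = e \<cdot> (b1 \<cdot> c2)"
      using c1(3) comp_assoc[OF c2(1) c1(2) e] by simp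
    have "m \<cdot> (x \<cdot> c1) = m \<cdot> (y \<cdot> c1)"
      using comp_assoc[OF c1(1) x m(1)] comp_assoc[OF c1(1) y m(1)] eq by simp
    then have "m \<cdot> ((x \<cdot> c1) \<cdot> c2) = m \<cdot> ((y \<cdot> c1) \<cdot> c2)"
      using comp_assoc[OF c2(1) h(2) m(1)] comp_assoc[OF c2(1) yc1 m(1)] by simp
    \<comment> \<open>The two lifts agree after \<open>g\<close>, so they form an arrow into the
      kernel pair \<open>R\<close>, whose legs \<open>e\<close> identifies.\<close>
    then have "g \<cdot> (b1 \<cdot> c2) = g \<cdot> b2"
      using xe c2(3) comp_assoc[OF h(1) e m(1)] comp_assoc[OF c2(2) e m(1)] m(2) by simp
    then obtain w where w: "w \<in> hom C X2 R" "r1 \<cdot> w = b1 \<cdot> c2" "r2 \<cdot> w = b2"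
      using pullback_lift[OF R g g h(1) c2(2)] by blast
    have "e \<cdot> (b1 \<cdot> c2) = e \<cdot> b2"
      using comp_assoc[OF w(1) r(1) e] comp_assoc[OF w(1) r(2) e] w(2,3) coequalizerD(1)[OF ce e]
      by simp
    then have "(x \<cdot> c1) \<cdot> c2 = (y \<cdot> c1) \<cdot> c2" using xe c2(3) by simp
    \<comment> \<open>The covers \<open>c2\<close> and \<open>c1\<close> are regular epimorphisms by
      stability and are cancelled in turn.\<close>
    then have "x \<cdot> c1 = y \<cdot> c1"
      using regular_epi_cancel[OF stable[OF X2 re] c2(1) h(2) yc1] by simp
    then show "x = y" using regular_epi_cancel[OF stable[OF X1 re] c1(1) x y] by simp
  qed
  then have "is_mono C m" using homD[OF m(1)] unfolding is_mono_def by simp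
  then show ?thesis using that R ce e m by blast
qed

section \<open>Reflectors, coreflectors and null arrows\<close>

text \<open>The inverse is the factorization of the identity of \<open>X\<close> through the unit;
  the second composite is the identity because the unit factors through itself in only one
  way.\<close>

lemma reflector_unit_iso:
  assumes refl: "reflector C S \<Phi> \<eta>" and S: "S \<subseteq> Obj C" and X: "X \<in> S"
  shows "is_iso C (\<eta> X)"
proof -
  have XO: "X \<in> Obj C" using S X by blast
  have \<eta>: "\<eta> X \<in> hom C X (fobj \<Phi> X)" using refl XO by (auto simp: reflector_def)
  have FX: "fobj \<Phi> X \<in> S" using refl XO by (auto simp: reflector_def is_functor_def)
  have univ: "\<And>Y f. Y \<in> S \<Longrightarrow> f \<in> hom C X Y \<Longrightarrow> \<exists>!h. h \<in> hom C (fobj \<Phi> X) Y \<and> h \<cdot> \<eta> X = f"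
    using refl XO by (auto simp: reflector_def)
  have i: "Ident C X \<in> hom C X X" "Ident C (fobj \<Phi> X) \<in> hom C (fobj \<Phi> X) (fobj \<Phi> X)"
    using ident_hom hom_objD[OF \<eta>] by auto
  obtain h where h: "h \<in> hom C (fobj \<Phi> X) X" "h \<cdot> \<eta> X = Ident C X" using univ[OF X i(1)] by blast
  have "(\<eta> X \<cdot> h) \<cdot> \<eta> X = \<eta> X"
    using comp_assoc[OF \<eta> h(1) \<eta>] h(2) ident_right[OF \<eta>] by simp
  moreover have "Ident C (fobj \<Phi> X) \<cdot> \<eta> X = \<eta> X" using ident_left[OF \<eta>] .
  ultimately have "\<eta> X \<cdot> h = Ident C (fobj \<Phi> X)"
    using univ[OF FX \<eta>] i(2) comp_hom[OF h(1) \<eta>] by (metis (no_types))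
  then show ?thesis using isoI[OF \<eta> h] by simp
qed

lemma comp_null_arrow:
  assumes "X \<in> Z" "u \<in> hom C A X" "v \<in> hom C X B"
  shows "v \<cdot> u \<in> null_arrows C Z"
proof -
  have "v \<cdot> u \<in> Arr C" "Dom C (v \<cdot> u) = A" "Cod C (v \<cdot> u) = B"
    using homD[OF comp_hom[OF assms(2,3)]] by auto
  then show ?thesis unfolding null_arrows_def using assms by blast
qed

text \<open>The arbitrary object of \<open>Z\<close> witnessing nullity is replaced by a canonical
  one: the second half of the factorization starts in \<open>Z\<close> and so passes through the
  counit.\<close>

lemma null_arrow_factor:
  assumes "coreflector C Z \<Psi> \<epsilon>" "f \<in> null_arrows C Z" and f: "f \<in> hom C A B"
  obtains u where "u \<in> hom C A (fobj \<Psi> B)" "\<epsilon> B \<cdot> u = f"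
proof -
  obtain X u v where *: "X \<in> Z" "u \<in> hom C A X" "v \<in> hom C X B" "f = v \<cdot> u"
    using assms unfolding null_arrows_def hom_def by auto
  have B: "B \<in> Obj C" using hom_objD[OF f] by blast
  then have \<epsilon>: "\<epsilon> B \<in> hom C (fobj \<Psi> B) B" using assms(1) by (auto simp: coreflector_def)
  obtain h where h: "h \<in> hom C X (fobj \<Psi> B)" "\<epsilon> B \<cdot> h = v"
    using assms(1) B *(1,3) unfolding coreflector_def by blast
  show ?thesis
    using that[OF comp_hom[OF *(2) h(1)]] comp_assoc[OF *(2) h(1) \<epsilon>] h(2) *(4) by simp
qed

text \<open>Hom-sets of the full subcategory are empty for objects outside it;
  \<open>empty_iff\<close> discards that branch of \<open>hom_full_sub\<close> and leaves hom-sets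
  of \<open>C\<close>.\<close>

lemma coreflector_arrow:
  assumes "coreflector C Z \<Psi> \<epsilon>" "f \<in> hom C A B"
  shows "farr \<Psi> f \<in> hom C (fobj \<Psi> A) (fobj \<Psi> B)" "\<epsilon> B \<cdot> farr \<Psi> f = f \<cdot> \<epsilon> A"
  using assms unfolding coreflector_def is_functor_def hom_full_sub
  by (metis empty_iff, metis)

lemma reflector_arrow:
  assumes "reflector C S \<Phi> \<eta>" "f \<in> hom C A B"
  shows "farr \<Phi> f \<in> hom C (fobj \<Phi> A) (fobj \<Phi> B)" "farr \<Phi> f \<cdot> \<eta> A = \<eta> B \<cdot> f"
  using assms unfolding reflector_def is_functor_def hom_full_sub
  by (metis empty_iff, metis)

section \<open>Z-cokernels as regular epimorphisms\<close>

text \<open>Let \<open>q = m \<cdot> e\<close> be the image factorization. Since the coreflector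
  inverts \<open>m\<close>, nullity of \<open>q \<cdot> f\<close> lifts to
  \<open>e \<cdot> f\<close>. An arrow coequalizing the kernel pair of \<open>q\<close> factors
  through \<open>e\<close>, so its composite with \<open>f\<close> is null, and the Z-cokernel
  property factors it uniquely through \<open>q\<close>.\<close>

lemma zcokernel_regular_epi:
  assumes "regular C" and zero: "class_of_zero_objects C Z \<Psi> \<epsilon>" and q: "is_zcokernel C Z q f"
  shows "is_regular_epi C q"
proof -
  have co: "coreflector C Z \<Psi> \<epsilon>" and inv: "\<And>m. is_mono C m \<Longrightarrow> is_iso C (farr \<Psi> m)"
    using zero by (auto simp: class_of_zero_objects_def)
  define A B D where "A = Dom C f" and "B = Cod C f" and "D = Cod C q"
  have fh: "f \<in> hom C A B" and qh: "q \<in> hom C B D" and nul: "q \<cdot> f \<in> null_arrows C Z"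
    and univ: "\<And>E e. e \<in> hom C B E \<Longrightarrow> e \<cdot> f \<in> null_arrows C Z \<Longrightarrow>
      \<exists>!h. h \<in> hom C D E \<and> h \<cdot> q = e"
    using q by (auto simp: is_zcokernel_def hom_def A_def B_def D_def)
  obtain R r1 r2 I e m where R: "is_pullback C q q R r1 r2" and ce: "is_coequalizer C r1 r2 e"
    and e: "e \<in> hom C B I" and m: "m \<in> hom C I D" "m \<cdot> e = q" "is_mono C m"
    using image_factorization[OF assms(1) qh] .
  note r = pullbackD[OF R qh qh]
  have I: "I \<in> Obj C" using hom_objD[OF m(1)] by blast
  then have \<epsilon>: "\<epsilon> I \<in> hom C (fobj \<Psi> I) I" and \<Psi>I: "fobj \<Psi> I \<in> Z"
    using co by (auto simp: coreflector_def is_functor_def)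
  note \<Psi>m = coreflector_arrow[OF co m(1)]
  obtain n where n: "n \<in> hom C (fobj \<Psi> D) (fobj \<Psi> I)" "farr \<Psi> m \<cdot> n = Ident C (fobj \<Psi> D)"
    using inv[OF m(3)] \<Psi>m(1) by (blast elim: isoE)
  have \<epsilon>D: "\<epsilon> D \<in> hom C (fobj \<Psi> D) D" using co hom_objD[OF m(1)] by (auto simp: coreflector_def)
  obtain u where u: "u \<in> hom C A (fobj \<Psi> D)" "\<epsilon> D \<cdot> u = q \<cdot> f"
    using null_arrow_factor[OF co nul comp_hom[OF fh qh]] .
  have nu: "n \<cdot> u \<in> hom C A (fobj \<Psi> I)" using comp_hom[OF u(1) n(1)] .
  \<comment> \<open>The inverse \<open>n\<close> of \<open>farr \<Psi> m\<close> moves the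
    factorization \<open>u\<close> of \<open>q \<cdot> f\<close> from the coreflection of
    \<open>D\<close> to that of \<open>I\<close>; cancelling \<open>m\<close> then exhibits
    \<open>e \<cdot> f\<close> as null.\<close>
  have "m \<cdot> (\<epsilon> I \<cdot> (n \<cdot> u)) = (\<epsilon> D \<cdot> farr \<Psi> m) \<cdot> (n \<cdot> u)"
    using comp_assoc[OF nu \<epsilon> m(1)] \<Psi>m(2) by simp
  also have "\<dots> = \<epsilon> D \<cdot> ((farr \<Psi> m \<cdot> n) \<cdot> u)"
    using comp_assoc[OF nu \<Psi>m(1) \<epsilon>D] comp_assoc[OF u(1) n(1) \<Psi>m(1)] by simp
  also have "\<dots> = m \<cdot> (e \<cdot> f)"
    using n(2) ident_left[OF u(1)] u(2) comp_assoc[OF fh e m(1)] m(2) by simp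
  finally have "\<epsilon> I \<cdot> (n \<cdot> u) = e \<cdot> f"
    using mono_cancel[OF m(3,1)] comp_hom[OF nu \<epsilon>] comp_hom[OF fh e] by blast
  then have "e \<cdot> f \<in> null_arrows C Z" using comp_null_arrow[OF \<Psi>I nu \<epsilon>] by simp
  then obtain h where h: "h \<in> hom C D I" "h \<cdot> q = e" using univ[OF e] by blast
  have "\<exists>!k. k \<in> hom C D X \<and> k \<cdot> q = d" if d: "d \<in> hom C B X" and eq: "d \<cdot> r1 = d \<cdot> r2" for X d
  proof -
    obtain d' where d': "d' \<in> hom C I X" "d' \<cdot> e = d" using coequalizer_factor[OF ce e d eq] .
    have *: "d' \<cdot> h \<in> hom C D X" "(d' \<cdot> h) \<cdot> q = d"
      using comp_hom[OF h(1) d'(1)] comp_assoc[OF qh h(1) d'(1)] h(2) d'(2) by simp_all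
    have "d \<cdot> f = d' \<cdot> (\<epsilon> I \<cdot> (n \<cdot> u))"
      using \<open>\<epsilon> I \<cdot> (n \<cdot> u) = e \<cdot> f\<close> comp_assoc[OF fh e d'(1)] d'(2) by simp
    also have "\<dots> = (d' \<cdot> \<epsilon> I) \<cdot> (n \<cdot> u)" using comp_assoc[OF nu \<epsilon> d'(1)] .
    finally have "d \<cdot> f = (d' \<cdot> \<epsilon> I) \<cdot> (n \<cdot> u)" .
    then have "d \<cdot> f \<in> null_arrows C Z"
      using comp_null_arrow[OF \<Psi>I nu comp_hom[OF \<epsilon> d'(1)]] by simp
    then show ?thesis using univ[OF d] by blast
  qed
  then have "is_coequalizer C r1 r2 q"
    using r homD[OF r(1)] homD[OF r(2)] homD[OF qh] unfolding is_coequalizer_def by simp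
  then show ?thesis by (auto simp: is_regular_epi_def)
qed

section \<open>Invertibility of the reflected pullback of the unit\<close>

lemma reflector_pullback_unit_iso:
  assumes reg: "regular C" and proto: "protomodular C"
    and zero: "class_of_zero_objects C Z \<Psi> \<epsilon>" and tt: "torsion_theory C Z T F"
    and ar: "associated_reflector C Z T F \<Theta> t \<Phi> \<eta>" and M': "condition_M' C \<Theta> \<Phi> \<Psi>"
    and B: "B \<in> Obj C" and A: "A \<in> F" and f: "f \<in> hom C A (fobj \<Phi> B)"
    and inv: "is_iso C (farr \<Psi> f)" and pb: "is_pullback C f (\<eta> B) P p q"
  shows "is_iso C (farr \<Phi> p)"
proof -
  have fc: "finitely_complete C"
    and stable: "\<And>f g P p q. is_pullback C f g P p q \<Longrightarrow> is_regular_epi C g \<Longrightarrow> is_regular_epi C p"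
    using reg unfolding regular_def by blast+
  have co: "coreflector C Z \<Psi> \<epsilon>" and Z: "replete C Z" "posetal C Z"
    and mono\<epsilon>: "\<And>A. A \<in> Obj C \<Longrightarrow> is_mono C (\<epsilon> A)"
    using zero by (auto simp: class_of_zero_objects_def)
  have refl: "reflector C F \<Phi> \<eta>"
    and seq: "\<And>A. A \<in> Obj C \<Longrightarrow> torsion_sequence C Z T F A (\<Theta> A) (t A) (fobj \<Phi> A) (\<eta> A)"
    using ar by (auto simp: associated_reflector_def)
  have F: "F \<subseteq> Obj C" "Z \<subseteq> F" and TF: "\<And>X Y. X \<in> T \<Longrightarrow> Y \<in> F \<Longrightarrow> hom C X Y \<subseteq> null_arrows C Z"
    using tt by (auto simp: torsion_theory_def replete_def)
  define S D where "S = \<Theta> B" and "D = fobj \<Phi> B"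
  have T: "S \<in> T" and D: "D \<in> F" and t: "t B \<in> hom C S B" and \<eta>: "\<eta> B \<in> hom C B D"
    and ker: "is_zkernel C Z (t B) (\<eta> B)" and cok: "is_zcokernel C Z (\<eta> B) (t B)"
    using seq[OF B] by (auto simp: torsion_sequence_def short_zexact_def S_def D_def)
  have fD: "f \<in> hom C A D" using f by (simp add: D_def)
  note pq = pullbackD[OF pb fD \<eta>]
  have obj: "A \<in> Obj C" "D \<in> Obj C" "P \<in> Obj C" "S \<in> Obj C"
    using hom_objD[OF fD] hom_objD[OF pq(1)] hom_objD[OF t] by auto
  have \<epsilon>: "\<And>X. X \<in> Obj C \<Longrightarrow> \<epsilon> X \<in> hom C (fobj \<Psi> X) X"
    and \<Psi>Z: "\<And>X. X \<in> Obj C \<Longrightarrow> fobj \<Psi> X \<in> Z"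
    using co by (auto simp: coreflector_def is_functor_def)
  have unit: "\<And>X. X \<in> Obj C \<Longrightarrow> \<eta> X \<in> hom C X (fobj \<Phi> X)"
    and \<Phi>F: "\<And>X. X \<in> Obj C \<Longrightarrow> fobj \<Phi> X \<in> F"
    and univ: "\<And>X Y g. X \<in> Obj C \<Longrightarrow> Y \<in> F \<Longrightarrow> g \<in> hom C X Y \<Longrightarrow>
      \<exists>!h. h \<in> hom C (fobj \<Phi> X) Y \<and> h \<cdot> \<eta> X = g"
    using refl by (auto simp: reflector_def is_functor_def)
  have re: "is_regular_epi C p" using stable[OF pb zcokernel_regular_epi[OF reg zero cok]] .

  \<comment> \<open>By naturality \<open>j\<close> is also
    \<open>\<epsilon> D \<cdot> farr \<Psi> f\<close>, a monic counit after an isomorphism. Being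
    monic, it lets arrows into the coreflection of \<open>A\<close> be compared in
    \<open>D\<close>.\<close>
  define j where "j = f \<cdot> \<epsilon> A"
  note \<Psi>f = coreflector_arrow[OF co fD]
  have j: "j \<in> hom C (fobj \<Psi> A) D" using comp_hom[OF \<epsilon>[OF obj(1)] fD] by (simp add: j_def)
  have mono_j: "is_mono C j"
    using mono_comp_iso[OF mono\<epsilon>[OF obj(2)] \<epsilon>[OF obj(2)] inv \<Psi>f(1)] \<Psi>f(2) by (simp add: j_def)
  obtain i where i: "i \<in> hom C (fobj \<Psi> D) (fobj \<Psi> A)" "farr \<Psi> f \<cdot> i = Ident C (fobj \<Psi> D)"
    using inv \<Psi>f(1) by (blast elim: isoE)
  have "\<eta> B \<cdot> t B \<in> null_arrows C Z" using ker by (simp add: is_zkernel_def)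
  then obtain u where u: "u \<in> hom C S (fobj \<Psi> D)" "\<epsilon> D \<cdot> u = \<eta> B \<cdot> t B"
    using null_arrow_factor[OF co _ comp_hom[OF t \<eta>]] by blast
  \<comment> \<open>The null arrow \<open>\<eta> B \<cdot> t B\<close> factors through the
    coreflection of \<open>D\<close> as \<open>u\<close>; the inverse \<open>i\<close> of
    \<open>farr \<Psi> f\<close> turns this into a factorization through the coreflection of
    \<open>A\<close>.\<close>
  define z where "z = i \<cdot> u"
  have z: "z \<in> hom C S (fobj \<Psi> A)" using comp_hom[OF u(1) i(1)] by (simp add: z_def)
  have \<Psi>z: "farr \<Psi> f \<cdot> z = u"
    using comp_assoc[OF u(1) i(1) \<Psi>f(1)] i(2) ident_left[OF u(1)] by (simp add: z_def)
  have jz: "j \<cdot> z = \<eta> B \<cdot> t B"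
    using comp_assoc[OF z \<Psi>f(1) \<epsilon>[OF obj(2)]] \<Psi>z u(2) \<Psi>f(2) by (simp add: j_def)
  have \<epsilon>z: "\<epsilon> A \<cdot> z \<in> hom C S A" using comp_hom[OF z \<epsilon>[OF obj(1)]] .
  have "f \<cdot> (\<epsilon> A \<cdot> z) = \<eta> B \<cdot> t B"
    using comp_assoc[OF z \<epsilon>[OF obj(1)] fD] jz by (simp add: j_def)
  \<comment> \<open>\<open>k\<close> lifts the torsion part of \<open>B\<close> to \<open>P\<close>,
    and \<open>p \<cdot> k\<close> is null through \<open>z\<close>.\<close>
  then obtain k where k: "k \<in> hom C S P" "p \<cdot> k = \<epsilon> A \<cdot> z" "q \<cdot> k = t B"
    using pullback_lift[OF pb fD \<eta> \<epsilon>z t] by blast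

  \<comment> \<open>Condition (M') enters here: up to isomorphism \<open>z\<close> is the reflection
    unit of \<open>S\<close>, so arrows from \<open>S\<close> to objects of \<open>Z\<close>, which
    lie in \<open>F\<close>, extend along it.\<close>
  have through_z: "\<exists>g \<in> hom C (fobj \<Psi> A) X. g \<cdot> z = y" if X: "X \<in> Z" and y: "y \<in> hom C S X" for X y
  proof -
    have \<Psi>D: "fobj \<Psi> D \<in> Z" using \<Psi>Z obj by blast
    obtain u' where u': "u' \<in> hom C (fobj \<Phi> S) (fobj \<Psi> D)" "u' \<cdot> \<eta> S = u"
      using univ[OF obj(4) _ u(1)] \<Psi>D F by blast
    obtain y' where y': "y' \<in> hom C (fobj \<Phi> S) X" "y' \<cdot> \<eta> S = y"
      using univ[OF obj(4) _ y] X F by blast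
    have "isomorphic C (fobj \<Phi> S) (fobj \<Psi> D)"
      using M' B by (simp add: condition_M'_def S_def D_def)
    then obtain a where a: "a \<in> hom C (fobj \<Phi> S) (fobj \<Psi> D)" "is_iso C a"
      by (auto simp: isomorphic_def)
    obtain b where b: "b \<in> hom C (fobj \<Psi> D) (fobj \<Phi> S)" "b \<cdot> a = Ident C (fobj \<Phi> S)"
      "a \<cdot> b = Ident C (fobj \<Psi> D)"
      using isoE[OF a(2,1)] .
    \<comment> \<open>Repleteness transports membership in \<open>Z\<close> from
      \<open>fobj \<Psi> D\<close>, hence the inverse direction. With both objects in
      \<open>Z\<close>, posetality identifies the induced arrow \<open>u'\<close> with the abstract
      isomorphism \<open>a\<close>.\<close>
    have "isomorphic C (fobj \<Psi> D) (fobj \<Phi> S)"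
      using isoI[OF b(1) a(1) b(3,2)] b(1) by (auto simp: isomorphic_def)
    then have "fobj \<Phi> S \<in> Z"
      using Z(1) \<Psi>D hom_objD[OF a(1)] unfolding replete_def by blast
    then have "u' = a" using Z(2) \<Psi>D u'(1) a(1) unfolding posetal_def by blast
    then have bu: "b \<cdot> u = \<eta> S"
      using u'(2) comp_assoc[OF unit[OF obj(4)] a(1) b(1)] b(2) ident_left[OF unit[OF obj(4)]]
      by simp
    have yb: "y' \<cdot> b \<in> hom C (fobj \<Psi> D) X" using comp_hom[OF b(1) y'(1)] .
    have "((y' \<cdot> b) \<cdot> farr \<Psi> f) \<cdot> z = y"
      using comp_assoc[OF z \<Psi>f(1) yb] \<Psi>z comp_assoc[OF u(1) b(1) y'(1)] bu y'(2) by simp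
    then show ?thesis using comp_hom[OF \<Psi>f(1) yb] by blast
  qed

  define E where "E = fobj \<Phi> P"
  have E: "E \<in> F" "E \<in> Obj C" using \<Phi>F[OF obj(3)] F by (auto simp: E_def)
  have \<eta>P: "\<eta> P \<in> hom C P E" using unit[OF obj(3)] by (simp add: E_def)
  have \<eta>k: "\<eta> P \<cdot> k \<in> hom C S E" using comp_hom[OF k(1) \<eta>P] .
  \<comment> \<open>An arrow from a torsion to a torsion-free object is null, so
    \<open>\<eta> P \<cdot> k\<close> factors through the coreflection of \<open>E\<close> and then,
    by \<open>through_z\<close>, through \<open>z\<close>.\<close>
  then obtain y where y: "y \<in> hom C S (fobj \<Psi> E)" "\<epsilon> E \<cdot> y = \<eta> P \<cdot> k"
    using null_arrow_factor[OF co _ \<eta>k] TF[OF T E(1)] by blast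
  obtain g where g: "g \<in> hom C (fobj \<Psi> A) (fobj \<Psi> E)" "g \<cdot> z = y"
    using through_z[OF \<Psi>Z[OF E(2)] y(1)] by blast
  have \<eta>k_eq: "\<eta> P \<cdot> k = (\<epsilon> E \<cdot> g) \<cdot> z"
    using comp_assoc[OF z g(1) \<epsilon>[OF E(2)]] g(2) y(2) by simp
  have \<epsilon>g: "\<epsilon> E \<cdot> g \<in> hom C (fobj \<Psi> A) E" using comp_hom[OF g(1) \<epsilon>[OF E(2)]] .

  obtain R r1 r2 where R: "is_pullback C p p R r1 r2" using pullback_exists[OF fc pq(1) pq(1)] .
  note r = pullbackD[OF R pq(1) pq(1)]
  have idP: "Ident C P \<in> hom C P P" using ident_hom obj by blast
  \<comment> \<open>The diagonal \<open>s\<close> splits \<open>r1\<close>. Pulling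
    \<open>r1\<close> back along \<open>k\<close> yields \<open>b\<close>, and protomodularity makes
    \<open>b\<close> and \<open>s\<close> enough to test equality of arrows out of
    \<open>R\<close>.\<close>
  obtain s where s: "s \<in> hom C P R" "r1 \<cdot> s = Ident C P" "r2 \<cdot> s = Ident C P"
    using pullback_lift[OF R pq(1) pq(1) idP idP] by blast
  obtain W a b where W: "is_pullback C k r1 W a b" using pullback_exists[OF fc k(1) r(1)] .
  note ab = pullbackD[OF W k(1) r(1)]
  have "is_section C r1 s" using s homD[OF r(1)] by (simp add: is_section_def)
  then have je: "jointly_extremally_epi C b s" using proto W unfolding protomodular_def by blast
  have r2b: "r2 \<cdot> b \<in> hom C W P" using comp_hom[OF ab(2) r(2)] .
  \<comment> \<open>Over \<open>W\<close> the first leg is \<open>k \<cdot> a\<close>, so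
    \<open>p\<close> also sends the second leg to a null arrow. Therefore
    \<open>q \<cdot> (r2 \<cdot> b)\<close> lifts along the Z-kernel \<open>t B\<close> to
    \<open>c\<close>, and eventually \<open>r2 \<cdot> b\<close> is
    \<open>k \<cdot> c\<close>.\<close>
  have "p \<cdot> (r2 \<cdot> b) = p \<cdot> (k \<cdot> a)"
    using comp_assoc[OF ab(2) r(1) pq(1)] comp_assoc[OF ab(2) r(2) pq(1)] r(3) ab(3) by simp
  also have "\<dots> = \<epsilon> A \<cdot> (z \<cdot> a)"
    using comp_assoc[OF ab(1) k(1) pq(1)] comp_assoc[OF ab(1) z \<epsilon>[OF obj(1)]] k(2) by simp
  finally have pr2b: "p \<cdot> (r2 \<cdot> b) = \<epsilon> A \<cdot> (z \<cdot> a)" .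
  have za: "z \<cdot> a \<in> hom C W (fobj \<Psi> A)" using comp_hom[OF ab(1) z] .
  have qr2b: "q \<cdot> (r2 \<cdot> b) \<in> hom C W B" using comp_hom[OF r2b pq(2)] .
  have \<eta>qr: "\<eta> B \<cdot> (q \<cdot> (r2 \<cdot> b)) = j \<cdot> (z \<cdot> a)"
    using comp_assoc[OF r2b pq(2) \<eta>] comp_assoc[OF r2b pq(1) fD] pq(3) pr2b
      comp_assoc[OF za \<epsilon>[OF obj(1)] fD] by (simp add: j_def)
  then have "\<eta> B \<cdot> (q \<cdot> (r2 \<cdot> b)) \<in> null_arrows C Z"
    using comp_null_arrow[OF \<Psi>Z[OF obj(1)] za j] by simp
  then obtain c where c: "c \<in> hom C W S" "t B \<cdot> c = q \<cdot> (r2 \<cdot> b)"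
    using ker qr2b homD[OF \<eta>] homD[OF t] unfolding is_zkernel_def by metis
  have zc: "z \<cdot> c \<in> hom C W (fobj \<Psi> A)" using comp_hom[OF c(1) z] .
  \<comment> \<open>\<open>a\<close> and \<open>c\<close> come from different legs; only their
    composites with \<open>z\<close> are claimed equal, and the monomorphism \<open>j\<close>
    detects this.\<close>
  have "j \<cdot> (z \<cdot> c) = j \<cdot> (z \<cdot> a)"
    using comp_assoc[OF c(1) z j] jz comp_assoc[OF c(1) t \<eta>] c(2) \<eta>qr by simp
  then have zca: "z \<cdot> c = z \<cdot> a" using mono_cancel[OF mono_j j zc za] by blast
  have kc: "k \<cdot> c = r2 \<cdot> b"
  proof (rule pullback_cancel[OF pb fD \<eta> comp_hom[OF c(1) k(1)] r2b])
    show "p \<cdot> (k \<cdot> c) = p \<cdot> (r2 \<cdot> b)"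
      using comp_assoc[OF c(1) k(1) pq(1)] k(2) comp_assoc[OF c(1) z \<epsilon>[OF obj(1)]] zca pr2b by simp
    show "q \<cdot> (k \<cdot> c) = q \<cdot> (r2 \<cdot> b)"
      using comp_assoc[OF c(1) k(1) pq(2)] k(3) c(2) by simp
  qed
  \<comment> \<open>On \<open>s\<close> both legs are the identity. On \<open>b\<close> they give
    \<open>(\<eta> P \<cdot> k) \<cdot> a\<close> and \<open>(\<eta> P \<cdot> k) \<cdot> c\<close>,
    equal because \<open>\<eta> P \<cdot> k\<close> factors through \<open>z\<close>.\<close>
  have "\<eta> P \<cdot> r1 = \<eta> P \<cdot> r2"
  proof (rule jointly_extremally_epi_cancel[OF fc je ab(2) s(1)])
    show "\<eta> P \<cdot> r1 \<in> hom C R E" "\<eta> P \<cdot> r2 \<in> hom C R E" using comp_hom r \<eta>P by blast+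
    have "(\<eta> P \<cdot> r1) \<cdot> b = (\<eta> P \<cdot> k) \<cdot> a"
      using comp_assoc[OF ab(2) r(1) \<eta>P] comp_assoc[OF ab(1) k(1) \<eta>P] ab(3) by simp
    also have "\<dots> = (\<eta> P \<cdot> k) \<cdot> c"
      using \<eta>k_eq comp_assoc[OF ab(1) z \<epsilon>g] comp_assoc[OF c(1) z \<epsilon>g] zca by simp
    also have "\<dots> = (\<eta> P \<cdot> r2) \<cdot> b"
      using comp_assoc[OF ab(2) r(2) \<eta>P] comp_assoc[OF c(1) k(1) \<eta>P] kc by simp
    finally show "(\<eta> P \<cdot> r1) \<cdot> b = (\<eta> P \<cdot> r2) \<cdot> b" .
    show "(\<eta> P \<cdot> r1) \<cdot> s = (\<eta> P \<cdot> r2) \<cdot> s"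
      using comp_assoc[OF s(1) r(1) \<eta>P] comp_assoc[OF s(1) r(2) \<eta>P] s by simp
  qed
  then obtain h where h: "h \<in> hom C A E" "h \<cdot> p = \<eta> P"
    using regular_epi_factor[OF re pq(1) R \<eta>P] by blast

  \<comment> \<open>\<open>p'\<close> is the comparison from the reflection of \<open>P\<close> to
    \<open>A\<close>, with inverse \<open>h\<close>: one composite is checked by cancelling the
    regular epimorphism \<open>p\<close>, the other by uniqueness of factorizations through
    \<open>\<eta> P\<close>.\<close>
  obtain p' where p': "p' \<in> hom C E A" "p' \<cdot> \<eta> P = p"
    using univ[OF obj(3) A pq(1)] by (auto simp: E_def)
  have "(p' \<cdot> h) \<cdot> p = Ident C A \<cdot> p"
    using comp_assoc[OF pq(1) h(1) p'(1)] h(2) p'(2) ident_left[OF pq(1)] by simp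
  then have ph: "p' \<cdot> h = Ident C A"
    using regular_epi_cancel[OF re pq(1) comp_hom[OF h(1) p'(1)]] ident_hom obj(1) by blast
  have "(h \<cdot> p') \<cdot> \<eta> P = \<eta> P" "Ident C E \<cdot> \<eta> P = \<eta> P"
    using comp_assoc[OF \<eta>P p'(1) h(1)] h(2) p'(2) ident_left[OF \<eta>P] by simp_all
  moreover have "h \<cdot> p' \<in> hom C E E" "Ident C E \<in> hom C E E"
    using comp_hom[OF p'(1) h(1)] ident_hom E(2) by auto
  ultimately have hp: "h \<cdot> p' = Ident C E"
    using univ[OF obj(3) E(1) \<eta>P] unfolding E_def by metis
  have isop: "is_iso C p'" using isoI[OF p'(1) h(1) hp ph] .
  note \<eta>A = unit[OF obj(1)] and \<Phi>p = reflector_arrow[OF refl pq(1)]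
  have \<eta>p: "\<eta> A \<cdot> p' \<in> hom C E (fobj \<Phi> A)" using comp_hom[OF p'(1) \<eta>A] .
  have "(\<eta> A \<cdot> p') \<cdot> \<eta> P = \<eta> A \<cdot> p"
    using comp_assoc[OF \<eta>P p'(1) \<eta>A] p'(2) by simp
  \<comment> \<open>Both sides become \<open>\<eta> A \<cdot> p\<close> after
    \<open>\<eta> P\<close>. As \<open>A\<close> lies in \<open>F\<close>, its unit is invertible,
    so invertibility of \<open>p'\<close> carries over.\<close>
  then have "farr \<Phi> p = \<eta> A \<cdot> p'"
    using univ[OF obj(3) \<Phi>F[OF obj(1)] comp_hom[OF pq(1) \<eta>A]] \<Phi>p \<eta>p unfolding E_def by metis
  then show ?thesis
    using iso_comp[OF p'(1) isop \<eta>A reflector_unit_iso[OF refl F(1) A]] by simp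
qed

end

theorem proposition4p9:
  fixes C :: "('o, 'a) cat"
    and Z T F :: "'o set"
    and \<Psi> \<Phi> :: "('o, 'a, 'o, 'a) cat_functor"
    and \<epsilon> \<eta> t :: "'o \<Rightarrow> 'a"
    and \<Theta> :: "'o \<Rightarrow> 'o"
  assumes "category C" "regular C" "protomodular C"
    and "class_of_zero_objects C Z \<Psi> \<epsilon>"
    and "torsion_theory C Z T F"
    and "associated_reflector C Z T F \<Theta> t \<Phi> \<eta>"
    and "condition_M' C \<Theta> \<Phi> \<Psi>"
  shows "(\<forall>A \<in> Obj C. \<exists>f. is_zcokernel C Z (\<eta> A) f) \<and>
    (\<forall>B \<in> Obj C. \<forall>A \<in> F. \<forall>f \<in> hom C A (fobj \<Phi> B). is_iso C (farr \<Psi> f) \<longrightarrow>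
       (\<forall>P p q. is_pullback C f (\<eta> B) P p q \<longrightarrow> is_iso C (farr \<Phi> p))) \<and>
    (\<forall>X \<in> Z. is_iso C (\<eta> X))"
proof -
  interpret category C by fact
  have seq: "\<And>A. A \<in> Obj C \<Longrightarrow> torsion_sequence C Z T F A (\<Theta> A) (t A) (fobj \<Phi> A) (\<eta> A)"
    and refl: "reflector C F \<Phi> \<eta>"
    using assms(6) by (auto simp: associated_reflector_def)
  have F: "F \<subseteq> Obj C" "Z \<subseteq> F" using assms(5) by (auto simp: torsion_theory_def replete_def)
  have "\<forall>A \<in> Obj C. \<exists>f. is_zcokernel C Z (\<eta> A) f"
    using seq unfolding torsion_sequence_def short_zexact_def by blast
  moreover have "\<forall>X \<in> Z. is_iso C (\<eta> X)" using reflector_unit_iso[OF refl F(1)] F(2) by blast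
  ultimately show ?thesis using reflector_pullback_unit_iso[OF assms(2-7)] by blast
qed

end
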